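(* Let $t\ge 0$. For $1\le k\le t$, the generating function (in $z$, marking length) of the partial Łukasiewicz paths of height at most $t$ ending at height $k$ is $$[u^k]\mathit{Total}_t(z,u)=(-1)^{k-1}\frac{N_3^{t-k+1}-N_2^{t-k}+N_2^{t-k+1}}{D_t}.$$ For $k=0$, $$[u^0]\mathit{Total}_t(z,u)=\frac{D_t+N_2^t+N_3^t}{D_t}.$$ The generating function for the total number of partial Łukasiewicz paths of height at most $t$ (with arbitrary end point) is $$\mathit{Total}_t(z,1)=(-1)^{t+1}D_t^{-1}=F_t^{-1}.$$
   Context: A partial Łukasiewicz path of length $n\ge 0$ is a lattice path starting at $(0,0)$, consisting of $n$ steps from $\{(1,j): j\ge -1\}$, and never going below the $x$-axis. Its height is the maximal $y$-coordinate of its points; it ends at height $k$ if its end point has $y$-coordinate $k$. $\mathit{Total}_t(z,u)$ is the bivariate generating function of all partial Łukasiewicz paths (including the empty one) of height at most $t$, with $z$ marking the length and $u$ marking the height of the end point; $[u^k]$ denotes coefficient extraction. The polynomials $D_t,N_2^t,N_3^t\in\mathbb{Z}[z]$ ($t\ge0$; the superscript is an index, not a power) each satisfy the recurrence $X_{t+2}+X_{t+1}+zX_t=0$ for $t\ge0$, with initial values $D_0=z-1,\ D_1=1-2z$; $\ N_2^0=0,\ N_2^1=z^2$; $\ N_3^0=-z,\ N_3^1=z(1-z)$. $F_t$ is the Fibonacci polynomial $F_t=1-\binom{t+1}{1}z+\binom{t}{2}z^2-\binom{t-1}{3}z^3+\cdots=\sum_{0\le j\le (t+2)/2}(-1)^j\binom{t+2-j}{j}z^j$.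 *)

theory Defs
  imports "HOL-Computational_Algebra.Computational_Algebra"
begin

text \<open>
  A lattice path is the list of the second components j of its steps (1,j); its length n is the
  length of the list, and its points are (i, ordinate p i) for 0 \<le> i \<le> n.
\<close>

definition ordinate :: "int list \<Rightarrow> nat \<Rightarrow> int" where
  "ordinate p i = sum_list (take i p)"

definition partial_lukasiewicz_path :: "int list \<Rightarrow> bool" where
  "partial_lukasiewicz_path p \<longleftrightarrow>
     (\<forall>j\<in>set p. j \<ge> -1) \<and> (\<forall>i\<le>length p. ordinate p i \<ge> 0)"

definition path_height :: "int list \<Rightarrow> int" where
  "path_height p = Max (ordinate p ` {..length p})"

definition end_height :: "int list \<Rightarrow> int" where
  "end_height p = ordinate p (length p)"

definition bounded_paths :: "nat \<Rightarrow> int list set" where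
  "bounded_paths t = {p. partial_lukasiewicz_path p \<and> path_height p \<le> int t}"

lemma bounded_paths_ordinate:
  assumes "p \<in> bounded_paths t" "i \<le> length p"
  shows "ordinate p i \<in> {0..int t}"
proof -
  have "ordinate p i \<le> path_height p"
    unfolding path_height_def using assms(2) by (intro Max_ge) auto
  then show ?thesis
    using assms by (auto simp: bounded_paths_def partial_lukasiewicz_path_def)
qed

text \<open>
  Only finitely many paths of bounded height have a given length, so the cardinalities and
  finite sums below are the intended ones.
\<close>

lemma finite_bounded_paths: "finite {p \<in> bounded_paths t. length p = n}"
proof -
  have "set p \<subseteq> {-1..int t}" if p: "p \<in> bounded_paths t" for p
  proof
    fix j assume j: "j \<in> set p"
    then obtain i where i: "i < length p" "p ! i = j"
      by (auto simp: in_set_conv_nth)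
    have "ordinate p (Suc i) = ordinate p i + j"
      using i by (simp add: ordinate_def take_Suc_conv_app_nth)
    moreover have "ordinate p i \<in> {0..int t}" "ordinate p (Suc i) \<in> {0..int t}"
      using bounded_paths_ordinate[OF p] i by auto
    moreover have "j \<ge> -1"
      using p j by (auto simp: bounded_paths_def partial_lukasiewicz_path_def)
    ultimately show "j \<in> {-1..int t}" by auto
  qed
  then have "{p \<in> bounded_paths t. length p = n} \<subseteq> {p. set p \<subseteq> {-1..int t} \<and> length p = n}"
    by auto
  then show ?thesis
    by (rule finite_subset) (rule finite_lists_length_eq, simp)
qed

definition path_gf :: "int list set \<Rightarrow> rat fps" where
  "path_gf A = Abs_fps (\<lambda>n. of_nat (card {p \<in> A. length p = n}))"

text \<open>
  The bivariate generating function is a power series in z whose coefficients are polynomials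
  in u, an element of Q[u][[z]]; this makes the substitution u = 1 meaningful.
\<close>

definition Total :: "nat \<Rightarrow> rat poly fps" where
  "Total t = Abs_fps (\<lambda>n. \<Sum>p \<in> {p \<in> bounded_paths t. length p = n}. monom 1 (nat (end_height p)))"

definition u_coeff :: "nat \<Rightarrow> rat poly fps \<Rightarrow> rat fps" where
  "u_coeff k G = Abs_fps (\<lambda>n. poly.coeff (fps_nth G n) k)"

definition u_eval :: "rat \<Rightarrow> rat poly fps \<Rightarrow> rat fps" where
  "u_eval c G = Abs_fps (\<lambda>n. poly (fps_nth G n) c)"

text \<open>The indeterminate z of Z[z] is [:0, 1:].\<close>

fun D :: "nat \<Rightarrow> int poly" where
  "D 0 = [:0, 1:] - 1"
| "D (Suc 0) = 1 - 2 * [:0, 1:]"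
| "D (Suc (Suc t)) = - D (Suc t) - [:0, 1:] * D t"

fun N2 :: "nat \<Rightarrow> int poly" where
  "N2 0 = 0"
| "N2 (Suc 0) = [:0, 1:] ^ 2"
| "N2 (Suc (Suc t)) = - N2 (Suc t) - [:0, 1:] * N2 t"

fun N3 :: "nat \<Rightarrow> int poly" where
  "N3 0 = - [:0, 1:]"
| "N3 (Suc 0) = [:0, 1:] * (1 - [:0, 1:])"
| "N3 (Suc (Suc t)) = - N3 (Suc t) - [:0, 1:] * N3 t"

definition F :: "nat \<Rightarrow> int poly" where
  "F t = (\<Sum>j = 0..(t + 2) div 2. (-1) ^ j * of_nat ((t + 2 - j) choose j) * [:0, 1:] ^ j)"

text \<open>
  Quotients are formed in Q[[z]]. All denominators that occur have constant term 1 or -1, so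
  these are genuine quotients (inverse is a true inverse on series with nonzero constant term).
\<close>

definition to_fps :: "int poly \<Rightarrow> rat fps" where
  "to_fps P = fps_of_poly (map_poly of_int P)"

lemma D_const_coeff: "poly.coeff (D t) 0 = (-1) ^ (t + 1)"
  by (induction t rule: D.induct) auto

lemma F_const_coeff: "poly.coeff (F t) 0 = 1"
proof -
  have "poly (F t) 0 = (\<Sum>j = 0..(t + 2) div 2. if j = 0 then 1 else 0)"
    unfolding F_def poly_sum by (intro sum.cong) auto
  then show ?thesis by (simp add: poly_0_coeff_0)
qed

end

theory Submission
  imports Defs
begin

text \<open>
  Let \<open>f k\<close> be the generating function of the paths of height at most \<open>t\<close> that end at height \<open>k\<close>,
  and let \<open>S\<close> be the sum of all \<open>f k\<close>.  A step can lead to height \<open>k\<close> from every height up to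
  \<open>k + 1\<close>, so removing the last step gives the linear system
  \<open>f k = [k = 0] + z * (f 0 + ... + f (min (k + 1) t))\<close>  (lemma \<open>ending_gf_system\<close>).

  At the top of the strip this reads \<open>f t = f (t - 1) = z * S\<close> up to the contribution of the empty
  path, and subtracting neighbouring equations gives \<open>f k = f (k + 1) - z * f (k + 2)\<close> below.  So
  the system is solved downwards from height \<open>t\<close>: at \<open>m\<close> levels below the top,
  \<open>f (t - m) = [m = t] + a m * S\<close>, where \<open>a m\<close> is a polynomial that does not depend on \<open>t\<close>
  (lemma \<open>staircase_system_solution\<close>).  Summation over all levels gives
  \<open>S * (1 - a 0 - ... - a t) = 1\<close>.

  The rest is a comparison of solutions of the recurrence \<open>X (t + 2) + X (t + 1) + z * X t = 0\<close>.
  Up to the sign \<open>(-1) ^ m\<close>, the polynomial \<open>a m\<close> is the numerator in the theorem for \<open>k = t - m\<close>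
  (for \<open>k = 0\<close> after one linear relation between the polynomials, and with the denominator added
  for the empty path); the factor
  \<open>1 - a 0 - ... - a t\<close> is \<open>(-1) ^ (t + 1) * D t\<close>; and Pascal's rule shows that the Fibonacci
  polynomial \<open>F t\<close> is the same polynomial.
\<close>

section \<open>Removing the last step of a path\<close>

lemma bounded_paths_iff:
  "p \<in> bounded_paths t \<longleftrightarrow>
     (\<forall>j\<in>set p. j \<ge> -1) \<and> (\<forall>i\<le>length p. 0 \<le> ordinate p i \<and> ordinate p i \<le> int t)"
proof -
  have "path_height p \<le> int t \<longleftrightarrow> (\<forall>i\<le>length p. ordinate p i \<le> int t)"
    unfolding path_height_def by (subst Max_le_iff) auto
  then show ?thesis
    by (auto simp: bounded_paths_def partial_lukasiewicz_path_def)
qed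

lemma Nil_in_bounded_paths: "[] \<in> bounded_paths t"
  by (simp add: bounded_paths_iff ordinate_def)

lemma snoc_in_bounded_paths_iff:
  "p @ [j] \<in> bounded_paths t \<longleftrightarrow>
     p \<in> bounded_paths t \<and> j \<ge> -1 \<and> 0 \<le> end_height p + j \<and> end_height p + j \<le> int t"
proof -
  have "(\<forall>i\<le>Suc (length p). Q (ordinate (p @ [j]) i)) \<longleftrightarrow>
      (\<forall>i\<le>length p. Q (ordinate p i)) \<and> Q (end_height p + j)" for Q
    by (auto simp: ordinate_def end_height_def le_Suc_eq)
  from this[of "\<lambda>y. 0 \<le> y \<and> y \<le> int t"] show ?thesis
    unfolding bounded_paths_iff by auto
qed

lemma end_height_in_range:
  "p \<in> bounded_paths t \<Longrightarrow> 0 \<le> end_height p \<and> end_height p \<le> int t"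
  by (simp add: bounded_paths_iff end_height_def)

definition paths_ending :: "nat \<Rightarrow> nat \<Rightarrow> nat \<Rightarrow> int list set" where
  "paths_ending t n k = {p \<in> bounded_paths t. length p = n \<and> end_height p = int k}"

lemma finite_paths_ending: "finite (paths_ending t n k)"
  by (rule finite_subset[OF _ finite_bounded_paths[of t n]]) (auto simp: paths_ending_def)

lemma paths_ending_0: "paths_ending t 0 k = (if k = 0 then {[]} else {})"
  by (auto simp: paths_ending_def Nil_in_bounded_paths end_height_def ordinate_def)

lemma paths_ending_Suc:
  assumes "k \<le> t"
  shows "paths_ending t (Suc n) k =
    (\<Union>i\<le>min (k + 1) t. (\<lambda>p. p @ [int k - int i]) ` paths_ending t n i)"
proof (intro equalityI subsetI)
  fix q assume q: "q \<in> paths_ending t (Suc n) k"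
  then obtain p j where pj: "q = p @ [j]"
    by (cases q rule: rev_cases) (auto simp: paths_ending_def)
  have p: "p \<in> bounded_paths t" "j \<ge> -1" "length p = n" "end_height p + j = int k"
    using q by (auto simp: pj paths_ending_def snoc_in_bounded_paths_iff
        end_height_def ordinate_def)
  define i where "i = nat (end_height p)"
  have i: "end_height p = int i" "i \<le> t"
    using end_height_in_range[OF p(1)] by (auto simp: i_def)
  have "q = p @ [int k - int i]" "i \<le> k + 1"
    using p(2,4) by (auto simp: pj i)
  moreover have "p \<in> paths_ending t n i"
    using p i by (simp add: paths_ending_def)
  ultimately show "q \<in> (\<Union>i\<le>min (k + 1) t. (\<lambda>p. p @ [int k - int i]) ` paths_ending t n i)"
    using i(2) by (intro UN_I[of i]) auto
next
  fix q assume "q \<in> (\<Union>i\<le>min (k + 1) t. (\<lambda>p. p @ [int k - int i]) ` paths_ending t n i)"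
  then show "q \<in> paths_ending t (Suc n) k"
    using assms by (auto simp: paths_ending_def snoc_in_bounded_paths_iff end_height_def ordinate_def)
qed

lemma card_paths_ending_Suc:
  assumes "k \<le> t"
  shows "card (paths_ending t (Suc n) k) = (\<Sum>i\<le>min (k + 1) t. card (paths_ending t n i))"
proof -
  have "card (paths_ending t (Suc n) k) =
      (\<Sum>i\<le>min (k + 1) t. card ((\<lambda>p. p @ [int k - int i]) ` paths_ending t n i))"
    unfolding paths_ending_Suc[OF assms]
    by (rule card_UN_disjoint) (auto simp: finite_paths_ending)
  also have "\<dots> = (\<Sum>i\<le>min (k + 1) t. card (paths_ending t n i))"
    by (intro sum.cong refl card_image) (simp add: inj_on_def)
  finally show ?thesis .
qed

section \<open>The generating functions by end height\<close>

definition ending_gf :: "nat \<Rightarrow> nat \<Rightarrow> rat fps" where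
  "ending_gf t k = path_gf {p \<in> bounded_paths t. end_height p = int k}"

lemma fps_nth_ending_gf: "fps_nth (ending_gf t k) n = of_nat (card (paths_ending t n k))"
  unfolding ending_gf_def path_gf_def paths_ending_def
  by (simp add: conj_ac)

lemma ending_gf_system:
  assumes "k \<le> t"
  shows "ending_gf t k = of_bool (k = 0) + fps_X * (\<Sum>i\<le>min (k + 1) t. ending_gf t i)"
proof (rule fps_ext)
  fix n
  show "fps_nth (ending_gf t k) n =
    fps_nth (of_bool (k = 0) + fps_X * (\<Sum>i\<le>min (k + 1) t. ending_gf t i)) n"
    using assms
    by (cases n) (auto simp: fps_nth_ending_gf fps_sum_nth paths_ending_0 card_paths_ending_Suc)
qed

lemma path_gf_eq_sum_ending_gf: "path_gf (bounded_paths t) = (\<Sum>k\<le>t. ending_gf t k)"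
proof (rule fps_ext)
  fix n
  have "{p \<in> bounded_paths t. length p = n} = (\<Union>k\<le>t. paths_ending t n k)"
  proof (intro equalityI subsetI)
    fix p assume p: "p \<in> {p \<in> bounded_paths t. length p = n}"
    then have "p \<in> paths_ending t n (nat (end_height p))" "nat (end_height p) \<le> t"
      using end_height_in_range[of p t] by (auto simp: paths_ending_def)
    then show "p \<in> (\<Union>k\<le>t. paths_ending t n k)" by auto
  qed (auto simp: paths_ending_def)
  moreover have "card (\<Union>k\<le>t. paths_ending t n k) = (\<Sum>k\<le>t. card (paths_ending t n k))"
    by (rule card_UN_disjoint) (auto simp: finite_paths_ending, auto simp: paths_ending_def)
  ultimately show "fps_nth (path_gf (bounded_paths t)) n = fps_nth (\<Sum>k\<le>t. ending_gf t k) n"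
    by (simp add: path_gf_def fps_sum_nth fps_nth_ending_gf)
qed

lemma u_coeff_Total: "u_coeff k (Total t) = ending_gf t k"
proof (rule fps_ext)
  fix n
  let ?P = "{p \<in> bounded_paths t. length p = n}"
  have "fps_nth (u_coeff k (Total t)) n = (\<Sum>p\<in>?P. of_bool (nat (end_height p) = k))"
    by (simp add: u_coeff_def Total_def coeff_sum of_bool_def)
  also have "\<dots> = of_nat (card {p \<in> ?P. nat (end_height p) = k})"
    by (simp add: sum_of_bool_eq finite_bounded_paths Int_def)
  also have "{p \<in> ?P. nat (end_height p) = k} = paths_ending t n k"
    using end_height_in_range by (fastforce simp: paths_ending_def)
  finally show "fps_nth (u_coeff k (Total t)) n = fps_nth (ending_gf t k) n"
    by (simp add: fps_nth_ending_gf)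
qed

lemma u_eval_1_Total: "u_eval 1 (Total t) = path_gf (bounded_paths t)"
  by (rule fps_ext) (simp add: u_eval_def Total_def path_gf_def poly_sum poly_monom)

section \<open>Solving the system from the top level downwards\<close>

text \<open>
  The equations for two neighbouring levels \<open>k\<close> and \<open>k + 1\<close> below the top differ only in the term
  \<open>z * f (k + 2)\<close>; this turns the system into a two-term recurrence for \<open>f\<close>, started at the top.
\<close>

lemma staircase_system_solution:
  fixes f a :: "nat \<Rightarrow> 'a::comm_ring_1"
  assumes f: "\<And>k. k \<le> t \<Longrightarrow> f k = of_bool (k = 0) + z * (\<Sum>i\<le>min (k + 1) t. f i)"
    and a: "a 0 = z" "a 1 = z" "\<And>m. a (m + 2) = a (m + 1) - z * a m"
  shows "m \<le> t \<Longrightarrow> f (t - m) = of_bool (m = t) + a m * (\<Sum>i\<le>t. f i)"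
proof (induction m rule: induct_nat_012)
  case 0
  show ?case using f[of t] a(1) by (cases "t = 0") simp_all
next
  case 1
  then have "min (t - 1 + 1) t = t" "t - 1 = 0 \<longleftrightarrow> 1 = t" by auto
  then show ?case using f[of "t - 1"] a(2) by simp
next
  case (ge2 m)
  define k where "k = t - m - 2"
  have t: "t = k + m + 2" using ge2.prems by (simp add: k_def)
  have "f k = of_bool (k = 0) + z * (\<Sum>i\<le>k + 1. f i)"
    using f[of k] by (simp add: t)
  moreover have "f (k + 1) = z * (\<Sum>i\<le>k + 2. f i)"
    using f[of "k + 1"] by (simp add: t)
  ultimately have "f k = of_bool (k = 0) + f (k + 1) - z * f (k + 2)"
    by (simp add: algebra_simps)
  moreover have "f (k + 1) = a (m + 1) * (\<Sum>i\<le>t. f i)" "f (k + 2) = a m * (\<Sum>i\<le>t. f i)"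
    using ge2.IH by (simp_all add: t)
  ultimately have "f k = of_bool (k = 0) + (a (m + 1) - z * a m) * (\<Sum>i\<le>t. f i)"
    by (simp add: algebra_simps)
  then have "f k = of_bool (k = 0) + a (m + 2) * (\<Sum>i\<le>t. f i)"
    by (simp only: a(3))
  then show ?case by (simp add: t)
qed

corollary staircase_system_sum:
  fixes f a :: "nat \<Rightarrow> 'a::comm_ring_1"
  assumes f: "\<And>k. k \<le> t \<Longrightarrow> f k = of_bool (k = 0) + z * (\<Sum>i\<le>min (k + 1) t. f i)"
    and a: "a 0 = z" "a 1 = z" "\<And>m. a (m + 2) = a (m + 1) - z * a m"
  shows "(\<Sum>k\<le>t. f k) * (1 - (\<Sum>m\<le>t. a m)) = 1"
proof -
  let ?S = "\<Sum>k\<le>t. f k"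
  have "?S = (\<Sum>m\<le>t. f (t - m))"
    by (rule sum.nat_diff_reindex[of f "Suc t", unfolded lessThan_Suc_atMost, simplified, symmetric])
  also have "\<dots> = (\<Sum>m\<le>t. of_bool (m = t) + a m * ?S)"
    using staircase_system_solution[OF f a] by (intro sum.cong) auto
  also have "\<dots> = 1 + (\<Sum>m\<le>t. a m) * ?S"
    by (simp add: sum.distrib sum_distrib_right of_bool_def)
  finally show ?thesis
    by (simp add: algebra_simps)
qed

section \<open>The polynomials\<close>

text \<open>
  The solution \<open>a\<close> of the recurrence in \<open>staircase_system_solution\<close>, in terms of the numerator of
  the theorem at height \<open>k = t - m\<close>.  The sign \<open>(-1) ^ m\<close> is the quotient of the sign
  \<open>(-1) ^ (k - 1)\<close> in the theorem and the sign \<open>(-1) ^ (t + 1)\<close> of the constant term of \<open>D t\<close>.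
\<close>

definition level_poly :: "nat \<Rightarrow> int poly" where
  "level_poly m = (-1) ^ m * (N3 (m + 1) - N2 m + N2 (m + 1))"

lemma level_poly_rec:
  "level_poly 0 = [:0, 1:]" "level_poly 1 = [:0, 1:]"
  "level_poly (m + 2) = level_poly (m + 1) - [:0, 1:] * level_poly m"
proof -
  show "level_poly 0 = [:0, 1:]" "level_poly 1 = [:0, 1:]"
    by (simp_all add: level_poly_def numeral_eq_Suc one_pCons)
  show "level_poly (m + 2) = level_poly (m + 1) - [:0, 1:] * level_poly m"
    by (simp add: level_poly_def algebra_simps)
qed

text \<open>
  This linear relation turns the numerator that the general solution gives at the bottom level,
  \<open>N3 (t + 1) - N2 t + N2 (t + 1)\<close>, into \<open>- (N2 t + N3 t)\<close>, the form used for end height 0.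
\<close>

lemma N3_consecutive_sum: "N3 t + N3 (t + 1) + N2 (t + 1) = 0"
proof (induction t rule: induct_nat_012)
  case (ge2 n)
  have "N3 (n + 2) + N3 (n + 3) + N2 (n + 3) =
      - (N3 (n + 1) + N3 (n + 2) + N2 (n + 2)) - [:0, 1:] * (N3 n + N3 (n + 1) + N2 (n + 1))"
    by (simp add: algebra_simps numeral_eq_Suc)
  also have "\<dots> = 0" using ge2 by simp
  finally show ?case by (simp add: numeral_eq_Suc)
qed (simp_all add: numeral_eq_Suc one_pCons)

lemma N2_plus_N3_eq_level_poly: "N2 t + N3 t = (-1) ^ (t + 1) * level_poly t"
proof -
  have "(-1) ^ (t + 1) * level_poly t = - (N3 (t + 1) - N2 t + N2 (t + 1))"
    by (simp add: level_poly_def flip: mult.assoc power_add mult_2)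
  also have "\<dots> = N2 t + N3 t - (N3 t + N3 (t + 1) + N2 (t + 1))" by simp
  also have "\<dots> = N2 t + N3 t" by (simp only: N3_consecutive_sum diff_zero)
  finally show ?thesis ..
qed

lemma signed_D_rec:
  "(-1) ^ (t + 3) * D (t + 2) = (-1) ^ (t + 2) * D (t + 1) - [:0, 1:] * ((-1) ^ (t + 1) * D t)"
  by (simp add: algebra_simps numeral_eq_Suc)

text \<open>
  The recurrence of \<open>level_poly\<close>, summed over all indices, telescopes to
  \<open>level_poly (t + 2) = z - z * (level_poly 0 + ... + level_poly t)\<close>.  Hence the left-hand side
  satisfies the same two-term recurrence as the right-hand side.
\<close>

lemma one_minus_sum_level_poly: "1 - (\<Sum>m\<le>t. level_poly m) = (-1) ^ (t + 1) * D t"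
proof (induction t rule: induct_nat_012)
  case 0
  show ?case by (simp add: level_poly_rec)
next
  case 1
  show ?case using level_poly_rec(1,2) by (simp add: one_pCons numeral_poly)
next
  case (ge2 t)
  have step: "level_poly (t + 2) = - [:0, 1:] * (\<Sum>m\<le>t. level_poly m) + [:0, 1:]" for t
  proof (induction t)
    case 0
    then show ?case using level_poly_rec(3)[of 0] level_poly_rec(1,2) by simp
  next
    case (Suc t)
    have "level_poly (Suc t + 2) = level_poly (t + 2) - [:0, 1:] * level_poly (Suc t)"
      using level_poly_rec(3)[of "Suc t"] by simp
    then show ?case unfolding Suc.IH sum.atMost_Suc by (simp only: algebra_simps)
  qed
  have "1 - (\<Sum>m\<le>t + 2. level_poly m) =
      (1 - (\<Sum>m\<le>t + 1. level_poly m)) - [:0, 1:] * (1 - (\<Sum>m\<le>t. level_poly m))"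
    using step[of t] by (simp add: algebra_simps)
  also have "\<dots> = (-1) ^ (t + 3) * D (t + 2)"
    unfolding signed_D_rec using ge2.IH by (simp only: Suc_eq_plus1 add.assoc one_add_one)
  finally show ?case by (simp add: numeral_eq_Suc)
qed

text \<open>
  The summation bound of \<open>F\<close> is invisible in its coefficients, because the binomial coefficients
  beyond it vanish, also those whose upper argument is truncated to 0.
\<close>

lemma coeff_F: "poly.coeff (F t) n = (-1) ^ n * int ((t + 2 - n) choose n)"
proof -
  have summand: "(-1) ^ j * of_nat c * [:0, 1:] ^ j = monom ((-1) ^ j * int c) j" for j c
    by (simp add: monom_altdef of_nat_poly poly_const_pow minus_one_power_iff one_pCons)
  have "poly.coeff (F t) n =
      (\<Sum>j = 0..(t + 2) div 2. if n = j then (-1) ^ n * int ((t + 2 - n) choose n) else 0)"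
    unfolding F_def summand coeff_sum by (intro sum.cong) auto
  then have "poly.coeff (F t) n =
      (if n \<le> (t + 2) div 2 then (-1) ^ n * int ((t + 2 - n) choose n) else 0)"
    by (simp only: sum.delta' finite_atLeastAtMost atLeastAtMost_iff zero_le simp_thms)
  moreover have "(t + 2 - n) choose n = 0" if "\<not> n \<le> (t + 2) div 2"
    using that by (intro binomial_eq_0) linarith
  ultimately show ?thesis by auto
qed

lemma F_rec: "F (t + 2) = F (t + 1) - [:0, 1:] * F t"
proof (rule poly_eqI)
  fix n
  show "poly.coeff (F (t + 2)) n = poly.coeff (F (t + 1) - [:0, 1:] * F t) n"
  proof (cases n)
    case (Suc j)
    have "(t + 2 + 2 - Suc j) choose Suc j =
        ((t + 1 + 2 - Suc j) choose Suc j) + ((t + 2 - j) choose j)"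
    proof (cases "j \<le> t + 2")
      case True
      then have "t + 2 + 2 - Suc j = Suc (t + 2 - j)" "t + 1 + 2 - Suc j = t + 2 - j" by auto
      then show ?thesis by simp
    qed (simp add: binomial_eq_0)
    then show ?thesis by (simp only: coeff_F coeff_diff Suc) (simp add: coeff_F algebra_simps)
  qed (simp add: coeff_F)
qed

lemma F_eq_signed_D: "F t = (-1) ^ (t + 1) * D t"
proof (induction t rule: induct_nat_012)
  case 0
  show ?case by (simp add: F_def one_pCons)
next
  case 1
  have "{0..(1 + 2) div 2} = {0, 1::nat}" by auto
  then show ?case by (simp add: F_def numeral_poly one_pCons)
next
  case (ge2 t)
  have "F (t + 2) = (-1) ^ (t + 3) * D (t + 2)"
    unfolding F_rec signed_D_rec using ge2.IH by (simp only: Suc_eq_plus1 add.assoc one_add_one)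
  then show ?case by (simp add: numeral_eq_Suc)
qed

section \<open>Passing to power series\<close>

lemma fps_nth_to_fps: "fps_nth (to_fps P) n = of_int (poly.coeff P n)"
  by (simp add: to_fps_def coeff_map_poly)

lemma to_fps_add: "to_fps (P + Q) = to_fps P + to_fps Q"
  and to_fps_diff: "to_fps (P - Q) = to_fps P - to_fps Q"
  and to_fps_uminus: "to_fps (- P) = - to_fps P"
  by (simp_all add: fps_eq_iff fps_nth_to_fps)

lemma to_fps_mult: "to_fps (P * Q) = to_fps P * to_fps Q"
  by (simp add: fps_eq_iff fps_nth_to_fps fps_mult_nth coeff_mult atMost_atLeast0)

lemma to_fps_0: "to_fps 0 = 0"
  and to_fps_1: "to_fps 1 = 1"
  and to_fps_X: "to_fps [:0, 1:] = fps_X"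
  by (auto simp: fps_eq_iff fps_nth_to_fps coeff_pCons fps_X_def split: nat.splits)

lemma to_fps_power: "to_fps (P ^ n) = to_fps P ^ n"
  by (induction n) (simp_all add: to_fps_1 to_fps_mult)

lemma to_fps_sum: "to_fps (\<Sum>i\<in>A. P i) = (\<Sum>i\<in>A. to_fps (P i))"
  by (induction A rule: infinite_finite_induct) (simp_all add: to_fps_0 to_fps_add)

lemmas to_fps_hom = to_fps_add to_fps_diff to_fps_uminus to_fps_mult to_fps_0 to_fps_1 to_fps_X
  to_fps_power to_fps_sum

lemma to_fps_level_poly_rec:
  "to_fps (level_poly 0) = fps_X" "to_fps (level_poly 1) = fps_X"
  "to_fps (level_poly (m + 2)) =
    to_fps (level_poly (m + 1)) - fps_X * to_fps (level_poly m)"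
  by (simp_all only: level_poly_rec to_fps_hom)

lemma to_fps_D_nth_0: "fps_nth (to_fps (D t)) 0 = (-1) ^ (t + 1)"
  by (simp add: fps_nth_to_fps D_const_coeff)

lemma path_gf_bounded_paths: "path_gf (bounded_paths t) = (-1) ^ (t + 1) * inverse (to_fps (D t))"
proof -
  have "path_gf (bounded_paths t) * (1 - (\<Sum>m\<le>t. to_fps (level_poly m))) = 1"
    unfolding path_gf_eq_sum_ending_gf
    by (rule staircase_system_sum[OF ending_gf_system to_fps_level_poly_rec])
  also have "1 - (\<Sum>m\<le>t. to_fps (level_poly m)) = (-1) ^ (t + 1) * to_fps (D t)"
    using arg_cong[OF one_minus_sum_level_poly, of to_fps t] by (simp add: to_fps_hom)
  finally have eq: "path_gf (bounded_paths t) * ((-1) ^ (t + 1) * to_fps (D t)) = 1" .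
  have "path_gf (bounded_paths t) * (-1) ^ (t + 1) = inverse (to_fps (D t))"
    using eq by (intro fps_inverse_unique[symmetric]) (simp add: ac_simps)
  then have "path_gf (bounded_paths t) * ((-1) ^ (t + 1) * (-1) ^ (t + 1)) =
      (-1) ^ (t + 1) * inverse (to_fps (D t))"
    by (simp only: mult.assoc[symmetric]) (simp add: mult.commute)
  then show ?thesis by (simp flip: power_add)
qed

lemma ending_gf_from_top:
  assumes "m \<le> t"
  shows "ending_gf t (t - m) = of_bool (m = t) +
    to_fps (level_poly m) * ((-1) ^ (t + 1) * inverse (to_fps (D t)))"
  unfolding path_gf_bounded_paths[symmetric] path_gf_eq_sum_ending_gf
  by (rule staircase_system_solution[OF ending_gf_system to_fps_level_poly_rec assms])

lemma divide_to_fps_D: "A / to_fps (D t) = A * inverse (to_fps (D t))"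
  by (rule fps_divide_unit) (simp add: to_fps_D_nth_0)

theorem theorem4:
  fixes t :: nat
  shows
    "(\<forall>k. 1 \<le> k \<and> k \<le> t \<longrightarrow>
        path_gf {p \<in> bounded_paths t. end_height p = int k} = u_coeff k (Total t) \<and>
        u_coeff k (Total t) =
          (-1) ^ (k - 1) * (to_fps (N3 (t - k + 1) - N2 (t - k) + N2 (t - k + 1)) / to_fps (D t))) \<and>
     (path_gf {p \<in> bounded_paths t. end_height p = 0} = u_coeff 0 (Total t) \<and>
        u_coeff 0 (Total t) = to_fps (D t + N2 t + N3 t) / to_fps (D t)) \<and>
     (path_gf (bounded_paths t) = u_eval 1 (Total t) \<and>
        u_eval 1 (Total t) = (-1) ^ (t + 1) * inverse (to_fps (D t)) \<and>
        (-1) ^ (t + 1) * inverse (to_fps (D t)) = inverse (to_fps (F t)))"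
proof (intro conjI allI impI)
  fix k assume k: "1 \<le> k \<and> k \<le> t"
  show "path_gf {p \<in> bounded_paths t. end_height p = int k} = u_coeff k (Total t)"
    by (simp add: u_coeff_Total ending_gf_def)
  define m where "m = t - k"
  have m: "m \<le> t" "t - m = k" "m \<noteq> t" "t + 1 + m = 2 * (m + 1) + (k - 1)"
    using k by (auto simp: m_def)
  have sign: "(-1) ^ (t + 1) * (-1) ^ m = ((-1) ^ (k - 1) :: rat fps)"
    unfolding power_add[symmetric] m(4) by (simp add: power_add power_mult)
  let ?N = "to_fps (N3 (m + 1) - N2 m + N2 (m + 1))"
  have "ending_gf t k = ((-1) ^ (t + 1) * (-1) ^ m) * (?N * inverse (to_fps (D t)))"
    using ending_gf_from_top[OF m(1)] m(2,3)
    by (simp add: level_poly_def to_fps_hom ac_simps)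
  then show "u_coeff k (Total t) =
      (-1) ^ (k - 1) * (to_fps (N3 (t - k + 1) - N2 (t - k) + N2 (t - k + 1)) / to_fps (D t))"
    unfolding sign unfolding u_coeff_Total divide_to_fps_D m_def .
next
  show "path_gf {p \<in> bounded_paths t. end_height p = 0} = u_coeff 0 (Total t)"
    by (simp add: u_coeff_Total ending_gf_def)
next
  have unit: "to_fps (D t) * inverse (to_fps (D t)) = 1"
    by (rule inverse_mult_eq_1') (simp add: to_fps_D_nth_0)
  have "ending_gf t 0 = 1 + to_fps (N2 t + N3 t) * inverse (to_fps (D t))"
    using ending_gf_from_top[of t t] unfolding N2_plus_N3_eq_level_poly
    by (simp add: to_fps_hom ac_simps)
  also have "\<dots> = to_fps (D t + (N2 t + N3 t)) * inverse (to_fps (D t))"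
    by (simp only: to_fps_add[of "D t"] distrib_right unit)
  finally show "u_coeff 0 (Total t) = to_fps (D t + N2 t + N3 t) / to_fps (D t)"
    by (simp add: u_coeff_Total divide_to_fps_D add.assoc)
next
  show "path_gf (bounded_paths t) = u_eval 1 (Total t)"
    by (simp only: u_eval_1_Total)
next
  show "u_eval 1 (Total t) = (-1) ^ (t + 1) * inverse (to_fps (D t))"
    by (simp only: u_eval_1_Total path_gf_bounded_paths)
next
  have "inverse (to_fps (F t)) = inverse ((-1) ^ (t + 1)) * inverse (to_fps (D t))"
    by (simp only: F_eq_signed_D to_fps_hom fps_inverse_mult)
  also have "inverse ((-1) ^ (t + 1)) = ((-1) ^ (t + 1) :: rat fps)"
    by (rule fps_inverse_unique) (simp flip: power_add)
  finally show "(-1) ^ (t + 1) * inverse (to_fps (D t)) = inverse (to_fps (F t))" ..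
qed

end
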